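(* Let $X\subseteq\mathbb{R}$ be a set of reals such that $(X[\leq])^2$ is normal. If there exists a strictly decreasing function $f:X\to X$ that is a homeomorphism of $X$ onto $X$ with respect to the Euclidean subspace topology, then $X$ is a $Q$-set.
   Context: For $X\subseteq\mathbb{R}$, $X[\leq]$ denotes $X$ with the subspace topology inherited from the Sorgenfrey line, i.e. from $\mathbb{R}$ with the topology generated by the half-open intervals $[a,b)$; $(X[\leq])^2$ is the product space $X[\leq]\times X[\leq]$. A $Q$-set is an uncountable subset of the reals with the property that every subset of it is $G_\delta$ (equivalently, every subset of it is $F_\sigma$) in the relative Euclidean subspace topology.
   Formalization: X is additionally assumed uncountable: a Q-set is uncountable by definition, and for countable X (e.g. the rationals with f(x) = -x) the hypotheses hold while the conclusion fails. *)

theory Defs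
  imports "HOL-Analysis.Analysis"
begin

definition sorgenfrey_line :: "real topology" where
  "sorgenfrey_line = topology_generated_by {{a..<b} | a b. a < b}"

definition sorgenfrey_subspace :: "real set \<Rightarrow> real topology" where
  "sorgenfrey_subspace X = subtopology sorgenfrey_line X"

definition Q_set :: "real set \<Rightarrow> bool" where
  "Q_set X \<longleftrightarrow> uncountable X \<and> (\<forall>A. A \<subseteq> X \<longrightarrow> gdelta_in (top_of_set X) A)"

end

theory Submission
  imports Defs
begin

text \<open>
  In the square of the Sorgenfrey line the graph of a decreasing continuous map \<open>f\<close> is closed and
  discrete: the box with lower left corner \<open>(x, f x)\<close> meets it only in that corner. By normality,
  the parts of the graph above \<open>B\<close> and above \<open>X - B\<close> have disjoint open neighbourhoods \<open>U\<close> and \<open>V\<close>.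
  If \<open>A\<^sub>n\<close> consists of the \<open>x \<in> B\<close> whose box of side \<open>1 / (n + 1)\<close> lies in \<open>U\<close>, then no
  \<open>y \<in> X - B\<close> is a Euclidean limit of \<open>A\<^sub>n\<close>, since for \<open>x \<in> A\<^sub>n\<close> close to \<open>y\<close> the boxes at
  \<open>(x, f x)\<close> and \<open>(y, f y)\<close> overlap. Hence \<open>B\<close> is the union of the closures of the \<open>A\<^sub>n\<close>.
\<close>

text \<open>An interval \<open>{a..<b}\<close> contains \<open>{x..<b}\<close> for each of its
  points \<open>x\<close>, and two right neighbourhoods of \<open>x\<close> meet in the shorter one,
  so the generating intervals already form a basis.\<close>

lemma openin_sorgenfrey_line:
  "openin sorgenfrey_line U \<longleftrightarrow> (\<forall>x\<in>U. \<exists>e>0. {x..<x+e} \<subseteq> U)"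
proof
  assume "openin sorgenfrey_line U"
  then have "generate_topology_on {{a..<b} | a b :: real. a < b} U"
    by (simp add: sorgenfrey_line_def openin_topology_generated_by_iff)
  then show "\<forall>x\<in>U. \<exists>e>0. {x..<x+e} \<subseteq> U"
  proof (induction rule: generate_topology_on.induct)
    case Empty
    then show ?case by simp
  next
    case (Int U V)
    show ?case
    proof
      fix x assume "x \<in> U \<inter> V"
      then obtain d e where "d > 0" "{x..<x+d} \<subseteq> U" "e > 0" "{x..<x+e} \<subseteq> V"
        using Int.IH by blast
      then have "min d e > 0 \<and> {x..<x + min d e} \<subseteq> U \<inter> V"
        by (auto simp: subset_iff)
      then show "\<exists>e>0. {x..<x+e} \<subseteq> U \<inter> V" by blast
    qed
  next
    case (UN K)
    then show ?case by (meson Union_iff Union_upper order_trans)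
  next
    case (Basis s)
    then obtain a b where s: "s = {a..<b}" by blast
    show ?case
    proof
      fix x assume "x \<in> s"
      then have "b - x > 0 \<and> {x..<x + (b - x)} \<subseteq> s" by (auto simp: s)
      then show "\<exists>e>0. {x..<x+e} \<subseteq> s" by blast
    qed
  qed
next
  assume U: "\<forall>x\<in>U. \<exists>e>0. {x..<x+e} \<subseteq> U"
  show "openin sorgenfrey_line U"
  proof (subst openin_subopen, intro ballI)
    fix x assume "x \<in> U"
    then obtain e where e: "e > 0" "{x..<x+e} \<subseteq> U" using U by blast
    have "openin sorgenfrey_line {x..<x+e}"
      unfolding sorgenfrey_line_def using e(1)
      by (intro topology_generated_by_Basis CollectI exI[of _ x] exI[of _ "x+e"]) simp
    then show "\<exists>T. openin sorgenfrey_line T \<and> x \<in> T \<and> T \<subseteq> U"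
      using e by (intro exI[of _ "{x..<x+e}"]) auto
  qed
qed

lemma topspace_sorgenfrey_subspace [simp]: "topspace (sorgenfrey_subspace X) = X"
proof -
  have "openin sorgenfrey_line UNIV"
    unfolding openin_sorgenfrey_line by (auto intro: exI[of _ 1])
  then have "topspace sorgenfrey_line = UNIV"
    using openin_subset by blast
  then show ?thesis
    by (simp add: sorgenfrey_subspace_def)
qed

lemma openin_sorgenfrey_subspace_Ico:
  "openin (sorgenfrey_subspace X) (X \<inter> {a..<b})"
proof -
  have "openin sorgenfrey_line {a..<b}"
    unfolding openin_sorgenfrey_line
  proof
    fix x assume "x \<in> {a..<b}"
    then have "b - x > 0 \<and> {x..<x + (b - x)} \<subseteq> {a..<b}" by auto
    then show "\<exists>e>0. {x..<x+e} \<subseteq> {a..<b}" by blast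
  qed
  then show ?thesis
    unfolding sorgenfrey_subspace_def by (rule openin_subtopology_Int2)
qed

text \<open>Shrinking both sides of a basic rectangle to their minimum gives a square box, so a
  single parameter \<open>e\<close> measures the size of a neighbourhood.\<close>

lemma openin_sorgenfrey_square:
  "openin (prod_topology (sorgenfrey_subspace X) (sorgenfrey_subspace X)) W \<longleftrightarrow>
    W \<subseteq> X \<times> X \<and>
    (\<forall>(a,b)\<in>W. \<exists>e>0. (X \<inter> {a..<a+e}) \<times> (X \<inter> {b..<b+e}) \<subseteq> W)"
  (is "?L \<longleftrightarrow> ?R")
proof
  assume L: ?L
  show ?R
  proof (intro conjI ballI, goal_cases)
    case 1
    then show ?case using openin_subset[OF L] by simp
  next
    case (2 p)
    obtain a b where p: "p = (a,b)" by (cases p)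
    then obtain U V where UV: "openin (sorgenfrey_subspace X) U" "openin (sorgenfrey_subspace X) V"
      "a \<in> U" "b \<in> V" "U \<times> V \<subseteq> W"
      using L[unfolded openin_prod_topology_alt, rule_format, of a b] 2 by auto
    then obtain S T where ST: "openin sorgenfrey_line S" "U = S \<inter> X"
      "openin sorgenfrey_line T" "V = T \<inter> X"
      unfolding sorgenfrey_subspace_def openin_subtopology by blast
    then obtain d e where de: "d > 0" "{a..<a+d} \<subseteq> S" "e > 0" "{b..<b+e} \<subseteq> T"
      using UV(3,4) unfolding openin_sorgenfrey_line by blast
    have "{a..<a + min d e} \<subseteq> {a..<a+d}" "{b..<b + min d e} \<subseteq> {b..<b+e}"
      by auto
    then have "(X \<inter> {a..<a + min d e}) \<times> (X \<inter> {b..<b + min d e}) \<subseteq> W"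
      using de ST UV(5) by blast
    then show ?case
      using de(1,3) unfolding p by (intro case_prodI exI[of _ "min d e"]) auto
  qed
next
  assume R: ?R
  show ?L
    unfolding openin_prod_topology_alt
  proof (intro allI impI)
    fix a b assume ab: "(a,b) \<in> W"
    then obtain e where e: "e > 0" "(X \<inter> {a..<a+e}) \<times> (X \<inter> {b..<b+e}) \<subseteq> W"
      using R by blast
    show "\<exists>U V. openin (sorgenfrey_subspace X) U \<and> openin (sorgenfrey_subspace X) V \<and>
        a \<in> U \<and> b \<in> V \<and> U \<times> V \<subseteq> W"
      using ab R e openin_sorgenfrey_subspace_Ico
      by (intro exI[of _ "X \<inter> {a..<a+e}"] exI[of _ "X \<inter> {b..<b+e}"]) auto
  qed
qed

text \<open>A point off the graph part has a box missing it: below the graph by continuity of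
  \<open>f\<close>, on or above it by monotonicity. Allowing every \<open>B\<close> is what makes
  the graph discrete as well as closed.\<close>

lemma closedin_decreasing_graph:
  fixes f :: "real \<Rightarrow> real"
  assumes f: "strict_antimono_on X f" "continuous_on X f" "f \<in> X \<rightarrow> X" and B: "B \<subseteq> X"
  shows "closedin (prod_topology (sorgenfrey_subspace X) (sorgenfrey_subspace X))
           ((\<lambda>x. (x, f x)) ` B)"
  unfolding closedin_def topspace_prod_topology topspace_sorgenfrey_subspace openin_sorgenfrey_square
proof (intro conjI ballI, goal_cases)
  case 1
  then show ?case using B f(3) by auto
next
  case 2
  then show ?case by blast
next
  case (3 p)
  obtain a b where p: "p = (a,b)" by (cases p)
  with 3 have ab: "a \<in> X" "b \<in> X" "(a,b) \<notin> (\<lambda>x. (x, f x)) ` B" by auto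
  have "\<exists>e>0. \<forall>x\<in>B. x \<in> {a..<a+e} \<longrightarrow> f x \<notin> {b..<b+e}"
  proof (cases "b < f a")
    case True
    \<comment> \<open>With half the gap as \<open>r\<close>, values within \<open>r\<close> of
      \<open>f a\<close> stay above \<open>b + r\<close>, hence above the whole box.\<close>
    define r where "r = (f a - b) / 2"
    have r: "r > 0" using True by (simp add: r_def)
    then obtain d where d: "d > 0" "\<And>x. x \<in> X \<Longrightarrow> dist x a < d \<Longrightarrow> dist (f x) (f a) < r"
      using f(2) ab(1) unfolding continuous_on_iff by meson
    have "f x \<notin> {b..<b + min d r}" if "x \<in> B" "x \<in> {a..<a + min d r}" for x
    proof -
      have "\<bar>f x - f a\<bar> < r"
        using that B d(2)[of x] by (auto simp: dist_real_def)
      then have "f x > f a - r" by linarith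
      then have "f x > b + r" by (simp add: r_def field_simps)
      then show ?thesis by auto
    qed
    then show ?thesis using d(1) r by (intro exI[of _ "min d r"]) auto
  next
    case False
    \<comment> \<open>Here \<open>f a \<le> b\<close>. To the right of \<open>a\<close> the graph
      drops strictly below \<open>f a\<close>; at \<open>a\<close> itself equality would put
      \<open>(a,b)\<close> on the graph part. Any side length therefore works, and 1 is
      chosen.\<close>
    have "f x < b" if "x \<in> B" "x \<ge> a" for x
    proof (cases "x = a")
      case True
      then show ?thesis using that ab(3) False by (auto simp: image_iff)
    next
      case x: False
      then have "f x < f a"
        using f(1) that B ab(1) by (auto simp: monotone_on_def)
      then show ?thesis using False by simp
    qed
    then show ?thesis by (intro exI[of _ 1]) force
  qed
  then show ?case unfolding p by fastforce
qed

lemma fsigma_in_if_normal_sorgenfrey_square: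
  fixes f :: "real \<Rightarrow> real"
  assumes normal: "normal_space (prod_topology (sorgenfrey_subspace X) (sorgenfrey_subspace X))"
    and f: "strict_antimono_on X f" "continuous_on X f" "f \<in> X \<rightarrow> X" and B: "B \<subseteq> X"
  shows "fsigma_in (top_of_set X) B"
proof -
  let ?g = "\<lambda>x. (x, f x)"
  have "closedin (prod_topology (sorgenfrey_subspace X) (sorgenfrey_subspace X)) (?g ` B)"
    "closedin (prod_topology (sorgenfrey_subspace X) (sorgenfrey_subspace X)) (?g ` (X - B))"
    using closedin_decreasing_graph[OF f] B by auto
  moreover have "disjnt (?g ` B) (?g ` (X - B))"
    by (auto simp: disjnt_def)
  ultimately obtain U V where
    U: "openin (prod_topology (sorgenfrey_subspace X) (sorgenfrey_subspace X)) U" "?g ` B \<subseteq> U" and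
    V: "openin (prod_topology (sorgenfrey_subspace X) (sorgenfrey_subspace X)) V" "?g ` (X - B) \<subseteq> V"
    and UV: "disjnt U V"
    using normal unfolding normal_space_def by meson
  define box where "box x e = (X \<inter> {x..<x+e}) \<times> (X \<inter> {f x..<f x+e})" for x e
  \<comment> \<open>The side depends on \<open>n\<close> only, so it does not shrink as points of
    \<open>A n\<close> approach a limit. \<open>Suc\<close> keeps it positive at
    \<open>n = 0\<close>.\<close>
  define A where "A n = {x \<in> B. box x (1 / Suc n) \<subseteq> U}" for n
  have "B = (\<Union>n. X \<inter> closure (A n))"
  proof (intro equalityI subsetI)
    fix x assume x: "x \<in> B"
    then obtain e where e: "e > 0" "box x e \<subseteq> U"
      using U unfolding openin_sorgenfrey_square box_def by blast
    obtain n where n: "1 / Suc n < e"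
      using e(1) nat_approx_posE by blast
    then have "box x (1 / Suc n) \<subseteq> box x e"
      by (auto simp: box_def)
    then have "x \<in> A n" using x e by (auto simp: A_def)
    then show "x \<in> (\<Union>n. X \<inter> closure (A n))"
      using x B closure_subset by blast
  next
    fix y assume "y \<in> (\<Union>n. X \<inter> closure (A n))"
    then obtain n where y: "y \<in> X" "y \<in> closure (A n)" by blast
    show "y \<in> B"
    proof (rule ccontr)
      assume "y \<notin> B"
      then obtain e where e: "e > 0" "box y e \<subseteq> V"
        using V y(1) unfolding openin_sorgenfrey_square box_def by blast
      define r where "r = min e (1 / Suc n)"
      have r: "r > 0" "r \<le> e" "r \<le> 1 / Suc n" using e(1) by (auto simp: r_def)
      obtain d where d: "d > 0" "\<And>x. x \<in> X \<Longrightarrow> dist x y < d \<Longrightarrow> dist (f x) (f y) < r"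
        using f(2) y(1) r(1) unfolding continuous_on_iff by meson
      \<comment> \<open>Closeness \<open>d\<close> controls \<open>f x - f y\<close> through
        continuity, and closeness \<open>r\<close> controls \<open>x - y\<close>; both differences
        end up below both box sides.\<close>
      obtain x where x: "x \<in> A n" "dist x y < min d r"
        using y(2) d(1) r(1) unfolding closure_approachable by (meson min_less_iff_conj)
      have xX: "x \<in> X" "x \<in> B" and xU: "box x (1 / Suc n) \<subseteq> U"
        using x(1) B by (auto simp: A_def)
      have near: "\<bar>x - y\<bar> < r" "\<bar>f x - f y\<bar> < r"
        using x(2) d(2)[OF xX(1)] by (auto simp: dist_real_def)
      have fX: "f x \<in> X" "f y \<in> X" using f(3) xX(1) y(1) by auto
      \<comment> \<open>The points differ because only \<open>x\<close> lies in \<open>B\<close>,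
        and \<open>f\<close> reverses their order. The common point of the boxes takes the larger of
        the two values in each coordinate.\<close>
      consider "x < y" "f y < f x" | "y < x" "f x < f y"
        using f(1) xX y(1) \<open>y \<notin> B\<close> unfolding monotone_on_def by (metis linorder_neqE)
      then have "\<exists>p. p \<in> box x (1 / Suc n) \<inter> box y e"
      proof cases
        case 1
        then show ?thesis
          using near r fX y(1) e(1) by (intro exI[of _ "(y, f x)"]) (auto simp: box_def)
      next
        case 2
        then show ?thesis
          using near r fX xX(1) e(1) by (intro exI[of _ "(x, f y)"]) (auto simp: box_def)
      qed
      then show False using xU e(2) UV by (auto simp: disjnt_def)
    qed
  qed
  moreover have "fsigma_in (top_of_set X) (\<Union>n. X \<inter> closure (A n))"
    by (intro fsigma_in_Union) (auto intro!: closed_imp_fsigma_in closedin_closed_Int)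
  ultimately show ?thesis by simp
qed

theorem proposition2p4:
  fixes X :: "real set"
  assumes "uncountable X"
    and "normal_space (prod_topology (sorgenfrey_subspace X) (sorgenfrey_subspace X))"
    and "\<exists>f :: real \<Rightarrow> real. strict_antimono_on X f \<and>
           homeomorphic_map (top_of_set X) (top_of_set X) f"
  shows "Q_set X"
proof -
  obtain f :: "real \<Rightarrow> real" where f: "strict_antimono_on X f"
    and hom: "homeomorphic_map (top_of_set X) (top_of_set X) f"
    using assms(3) by blast
  have "continuous_map (top_of_set X) (top_of_set X) f"
    using hom by (rule homeomorphic_imp_continuous_map)
  then have "continuous_on X f" "f \<in> X \<rightarrow> X"
    by (auto simp: continuous_map_subtopology_eu)
  then have "fsigma_in (top_of_set X) B" if "B \<subseteq> X" for B
    using fsigma_in_if_normal_sorgenfrey_square[OF assms(2) f] that by blast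
  \<comment> \<open>A set is a \<open>G_delta\<close> in \<open>X\<close> when its complement in
    \<open>X\<close> is an \<open>F_sigma\<close>, and that complement is again a subset of
    \<open>X\<close>.\<close>
  then show ?thesis
    using assms(1) by (simp add: Q_set_def gdelta_in_fsigma_in)
qed

end
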